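(* For every integer $d\ge 3$, the following assertion is false: for every positive integer $n$ and every Bollobás system $\mathcal{D}=\{(A_i^{(1)},\ldots,A_i^{(d)})\}_{1\leq i\leq m}$ of $d$-partitions of $[n]$, $$\sum_{i=1}^m\binom{\sum_{r=1}^{d}|A_i^{(r)}|}{|A_i^{(1)}|,\ldots,|A_i^{(d)}|}^{-1}\leq 1.$$ That is, for every $d\ge 3$ there exist a positive integer $n$ and a Bollobás system of $d$-partitions of $[n]$ for which the sum on the left-hand side is strictly greater than $1$.
   Context: For a positive integer $n$, $[n]=\{1,\dots,n\}$. For $d\ge 2$, a $d$-partition of $[n]$ is a tuple $(A^{(1)},\dots,A^{(d)})$ of (possibly empty) pairwise disjoint subsets of $[n]$; their union need not be all of $[n]$. A family $\{(A_i^{(1)},\dots,A_i^{(d)})\}_{1\le i\le m}$ of $d$-partitions of $[n]$ is a Bollobás system if for any $1\le i,j\le m$ with $i\ne j$ there exist $1\le p<q\le d$ such that $A_i^{(p)}\cap A_j^{(q)}\neq\emptyset$. For non-negative integers $a_1,\ldots,a_d$ with $a_1+\cdots+a_d\le N$, $\binom{N}{a_1,\ldots,a_d}=\frac{N!}{a_1!\cdots a_d!(N-a_1-\cdots-a_d)!}$. *)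

theory Defs
  imports Complex_Main "HOL-Library.Disjoint_Sets"
begin

(* A tuple is a function P of which only the components P 1, ..., P d matter.
   disjoint_family_on compares components by index, so repeated empty components are allowed. *)
definition d_partition :: "nat \<Rightarrow> nat \<Rightarrow> (nat \<Rightarrow> nat set) \<Rightarrow> bool" where
  "d_partition d n P \<longleftrightarrow>
     (\<forall>r\<in>{1..d}. P r \<subseteq> {1..n}) \<and> disjoint_family_on P {1..d}"

(* The condition on A i, A j ranges over ordered pairs: it is also imposed with i and j exchanged. *)
definition bollobas_system ::
    "nat \<Rightarrow> nat \<Rightarrow> nat \<Rightarrow> (nat \<Rightarrow> nat \<Rightarrow> nat set) \<Rightarrow> bool" where
  "bollobas_system d n m A \<longleftrightarrow>
     (\<forall>i\<in>{1..m}. d_partition d n (A i)) \<and>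
     (\<forall>i\<in>{1..m}. \<forall>j\<in>{1..m}. i \<noteq> j \<longrightarrow>
        (\<exists>p q. 1 \<le> p \<and> p < q \<and> q \<le> d \<and> A i p \<inter> A j q \<noteq> {}))"

(* Meaningful for a 1 + ... + a d \<le> N, since the subtraction on nat truncates. *)
definition multinomial :: "nat \<Rightarrow> nat \<Rightarrow> (nat \<Rightarrow> nat) \<Rightarrow> real" where
  "multinomial N d a =
     fact N / ((\<Prod>r=1..d. fact (a r)) * fact (N - (\<Sum>r=1..d. a r)))"

end

theory Submission
  imports Defs
begin

text \<open>
  Partitions of all of \<open>{1..n}\<close> into \<open>d\<close> classes are words of length \<open>n\<close> over the alphabet
  \<open>{1..d}\<close>, and the Bollobas condition says that, of any two words, neither dominates the other
  letter by letter. For \<open>d \<ge> 3\<close> all words with a fixed sum of letters form such an antichain,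
  while they may have several types \<open>(a\<^sub>1, \<dots>, a\<^sub>d)\<close>, where \<open>a\<^sub>r\<close> counts the letters \<open>r\<close>.
  All words of one type together contribute exactly \<open>1\<close> to the sum, so two types suffice.
  (For \<open>d = 2\<close> the sum of the letters determines the type.)

  The smallest instance is \<open>n = 2\<close> with letter sum \<open>4\<close>: the words \<open>13\<close> and \<open>31\<close> contribute
  \<open>1/2\<close> each and the word \<open>22\<close> contributes \<open>1\<close>, so the total is \<open>2\<close>. Using only the letters
  \<open>1, 2, 3\<close>, it serves every \<open>d \<ge> 3\<close>, the remaining classes being empty.
\<close>

definition word :: "nat \<Rightarrow> nat \<Rightarrow> nat" where
  "word i x = (if i = 1 then (if x = 1 then 1 else 3)
               else if i = 2 then (if x = 1 then 3 else 1) else 2)"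

definition letter_class :: "nat \<Rightarrow> nat \<Rightarrow> nat set" where
  "letter_class i r = {x \<in> {1..2}. word i x = r}"

text \<open>All three words have letter sum \<open>4\<close>, so a word that differs from another has a smaller
  letter at some position; the two letters there serve as \<open>p < q\<close>.\<close>

lemma bollobas_system_letter_class:
  assumes "d \<ge> 3"
  shows "bollobas_system d 2 3 letter_class"
proof -
  have "d_partition d 2 (letter_class i)" for i
    by (auto simp: d_partition_def disjoint_family_on_def letter_class_def)
  moreover have "\<exists>p q. 1 \<le> p \<and> p < q \<and> q \<le> d \<and> letter_class i p \<inter> letter_class j q \<noteq> {}"
    if "i \<in> {1..3}" "j \<in> {1..3}" "i \<noteq> j" for i j
  proof -
    have "i = 1 \<or> i = 2 \<or> i = 3" "j = 1 \<or> j = 2 \<or> j = 3"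
      using that by auto
    then have "word i 1 < word j 1 \<or> word i 2 < word j 2"
      using \<open>i \<noteq> j\<close> by (elim disjE) (simp_all add: word_def)
    moreover have "(1::nat) \<in> {1..2}" "(2::nat) \<in> {1..2}" by simp_all
    ultimately obtain x where x: "x \<in> {1..2}" "word i x < word j x" by blast
    then have "x \<in> letter_class i (word i x) \<inter> letter_class j (word j x)"
      by (simp add: letter_class_def)
    moreover have "1 \<le> word i x" "word j x \<le> d"
      using assms by (auto simp: word_def)
    ultimately show ?thesis using x(2) by blast
  qed
  ultimately show ?thesis by (simp add: bollobas_system_def)
qed

text \<open>Letters beyond \<open>3\<close> do not occur, so the empty classes of a tuple only contribute
  factors \<open>fact 0 = 1\<close> and the weight does not depend on \<open>d\<close>.\<close>

lemma inverse_multinomial_letter_class: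
  assumes "d \<ge> 3"
  shows "inverse (multinomial (\<Sum>r=1..d. card (letter_class i r)) d (\<lambda>r. card (letter_class i r)))
    = (if i = 1 \<or> i = 2 then 1/2 else 1)"
proof -
  have "card (letter_class i r) = (if i = 1 \<or> i = 2 then (if r = 1 \<or> r = 3 then 1 else 0)
          else (if r = 2 then 2 else 0))" for r
  proof -
    have "{1..2::nat} = {1, 2}" by auto
    then have "letter_class i r = (if word i 1 = r then {1} else {}) \<union> (if word i 2 = r then {2} else {})"
      by (auto simp: letter_class_def)
    then show ?thesis by (auto simp: word_def)
  qed
  note card_eq = this
  have split: "{1..d} = {1, 2, 3} \<union> {4..d}" using assms by auto
  have "(\<Sum>r=1..d. card (letter_class i r)) = 2"
    unfolding split by (subst sum.union_disjoint) (auto simp: card_eq)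
  moreover have "(\<Prod>r=1..d. fact (card (letter_class i r)))
      = (if i = 1 \<or> i = 2 then 1 else 2 :: real)"
    unfolding split by (subst prod.union_disjoint) (auto simp: card_eq)
  ultimately show ?thesis by (simp add: multinomial_def)
qed

theorem mainTheorem3:
  fixes d :: nat
  assumes "d \<ge> 3"
  shows "\<not> (\<forall>(n::nat) (m::nat) (A :: nat \<Rightarrow> nat \<Rightarrow> nat set).
            n \<ge> 1 \<longrightarrow> bollobas_system d n m A \<longrightarrow>
            (\<Sum>i=1..m. inverse (multinomial (\<Sum>r=1..d. card (A i r)) d (\<lambda>r. card (A i r)))) \<le> 1)"
proof
  assume bound: "\<forall>(n::nat) (m::nat) (A :: nat \<Rightarrow> nat \<Rightarrow> nat set).
            n \<ge> 1 \<longrightarrow> bollobas_system d n m A \<longrightarrow>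
            (\<Sum>i=1..m. inverse (multinomial (\<Sum>r=1..d. card (A i r)) d (\<lambda>r. card (A i r)))) \<le> 1"
  have "{1..3::nat} = {1, 2, 3}" by auto
  then have "(\<Sum>i=1..3. inverse (multinomial (\<Sum>r=1..d. card (letter_class i r)) d
      (\<lambda>r. card (letter_class i r)))) = 2"
    by (simp add: inverse_multinomial_letter_class[OF assms] del: One_nat_def)
  moreover have "(\<Sum>i=1..3. inverse (multinomial (\<Sum>r=1..d. card (letter_class i r)) d
      (\<lambda>r. card (letter_class i r)))) \<le> 1"
    by (rule bound[rule_format, OF one_le_numeral bollobas_system_letter_class[OF assms]])
  ultimately show False by linarith
qed

end
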